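(* Let $d\ge 3$ and $n\ge d+1$ be integers. There exists a $d$-dimensional convex polytope $P\subset\mathbb{R}^d$ with exactly $n$ vertices such that $P=-P^\circ$ if and only if $n\ne d+2$.
   Context: For $A\subseteq\mathbb{R}^d$, the polar is $A^\circ=\{x\in\mathbb{R}^d:\langle x,a\rangle\le 1\text{ for all }a\in A\}$, and $-A=\{-a:a\in A\}$. *)

theory Defs
  imports "HOL-Analysis.Analysis"
begin

definition polar :: "('a::real_inner) set \<Rightarrow> 'a set" where
  "polar A = {x. \<forall>a\<in>A. x \<bullet> a \<le> 1}"

end

theory Submission
  imports Defs
begin

text \<open>
  Let \<open>P = - polar P\<close> with vertex set \<open>V\<close>. Then \<open>P = {x. \<forall>v\<in>V. -1 \<le> x \<bullet> v}\<close>, and the entries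
  \<open>a \<bullet> b + 1\<close> form a positive semidefinite matrix \<open>M\<close> with nonnegative entries, whose zeros record
  incidences of vertices and facets. If there are \<open>d + 2\<close> vertices, each row of \<open>M\<close> has at most two
  nonzero entries. An affine dependence \<open>l\<close> lies in the kernel of \<open>M\<close>, so a vertex \<open>a\<close> with
  \<open>l a \<noteq> 0\<close> is matched with some \<open>b\<close> such that \<open>l a *\<^sub>R (a, 1) + l b *\<^sub>R (b, 1)\<close> is in the kernel
  of the Gram matrix, hence zero, and \<open>a = b\<close>.

  For existence, two operations preserve negative self-polarity together with a simple vertex:
  pyramids map \<open>(d, n)\<close> to \<open>(d + 1, n + 1)\<close>, and adding a point beyond the facet dual to a simple
  vertex while cutting off that vertex maps \<open>(d, n)\<close> to \<open>(d, n + d)\<close>. Starting from a point, the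
  plane yields all odd \<open>n \<ge> 3\<close>; pyramids and one more cut yield all \<open>n \<ge> 4\<close> with \<open>n \<noteq> 5\<close> in
  dimension three, and pyramids keep \<open>n - d\<close> fixed from there on.
\<close>


section \<open>Negatively self-polar vertex sets\<close>

lemma inner_self_ne_minus_one: "x \<bullet> x \<noteq> -1" for x :: "'a::real_inner"
  by (smt (verit) inner_ge_zero)

text \<open>The easy half of \<open>hull_V\<close> for both constructions: the constraints cut out a
  convex set, so they need checking only on pairs from \<open>V\<close>.\<close>

lemma hull_subset_if_pairwise:
  fixes S V :: "'a::real_inner set"
  assumes "subspace S" and "V \<subseteq> S" and "\<And>p p'. \<lbrakk>p \<in> V; p' \<in> V\<rbrakk> \<Longrightarrow> -1 \<le> p \<bullet> p'"
  shows "convex hull V \<subseteq> {y \<in> S. \<forall>p\<in>V. -1 \<le> y \<bullet> p}"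
proof (rule hull_minimal)
  show "V \<subseteq> {y \<in> S. \<forall>p\<in>V. -1 \<le> y \<bullet> p}" using assms by auto
  have "{y \<in> S. \<forall>p\<in>V. -1 \<le> y \<bullet> p} = S \<inter> (\<Inter>p\<in>V. {y. p \<bullet> y \<ge> -1})"
    by (auto simp: inner_commute)
  then show "convex {y \<in> S. \<forall>p\<in>V. -1 \<le> y \<bullet> p}"
    using subspace_imp_convex[OF assms(1)]
    by (simp add: convex_Int convex_INT convex_halfspace_ge)
qed

text \<open>The last axiom states that the constraints active at a point of \<open>V\<close> determine it, which is
  how extremality is encoded; the ambient space is a subspace \<open>S\<close> so that the dimension can grow
  in an induction.\<close>

locale neg_self_polar =
  fixes S V :: "'a::euclidean_space set"
  assumes subspace_S: "subspace S"
    and finite_V: "finite V"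
    and V_subset: "V \<subseteq> S"
    and hull_V: "convex hull V = {x \<in> S. \<forall>v\<in>V. -1 \<le> x \<bullet> v}"
    and active: "\<lbrakk>y \<in> V; z \<in> S; \<And>u. \<lbrakk>u \<in> V; y \<bullet> u = -1\<rbrakk> \<Longrightarrow> z \<bullet> u = 0\<rbrakk> \<Longrightarrow> z = 0"
begin

lemma V_in_S: "y \<in> V \<Longrightarrow> y \<in> S"
  using V_subset by auto

lemma inner_ge: "\<lbrakk>y \<in> convex hull V; p \<in> V\<rbrakk> \<Longrightarrow> -1 \<le> y \<bullet> p"
  using hull_V by auto

lemma inner_ge_V: "\<lbrakk>y \<in> V; p \<in> V\<rbrakk> \<Longrightarrow> -1 \<le> y \<bullet> p"
  by (meson hull_inc inner_ge)

lemma V_nonempty: "V \<noteq> {}"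
proof
  assume "V = {}"
  then show False using subspace_0[OF subspace_S] hull_V by auto
qed

text \<open>Otherwise the ray spanned by \<open>z\<close> would lie in the bounded set
  \<open>convex hull V\<close>.\<close>

lemma no_recession:
  assumes "z \<in> S" and "\<And>v. v \<in> V \<Longrightarrow> 0 \<le> z \<bullet> v"
  shows "z = 0"
proof (rule ccontr)
  assume "z \<noteq> 0"
  obtain B where B: "\<And>p. p \<in> convex hull V \<Longrightarrow> norm p \<le> B"
    using finite_V bounded_convex_hull finite_imp_bounded bounded_iff by metis
  define t where "t = (\<bar>B\<bar> + 1) / norm z"
  have t: "0 < t" using \<open>z \<noteq> 0\<close> by (simp add: t_def add_nonneg_pos)
  have "-1 \<le> (t *\<^sub>R z) \<bullet> v" if "v \<in> V" for v
  proof -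
    have "0 \<le> t * (z \<bullet> v)" using t assms(2)[OF that] by simp
    then show ?thesis by simp
  qed
  then have "t *\<^sub>R z \<in> convex hull V"
    using assms(1) subspace_S by (simp add: hull_V subspace_scale)
  moreover have "norm (t *\<^sub>R z) = \<bar>B\<bar> + 1"
    using t \<open>z \<noteq> 0\<close> by (simp add: t_def)
  ultimately show False using B by force
qed

text \<open>A constraint active in the interior of a segment of the hull is active at both
  endpoints, so \<open>active\<close> forces the direction of the segment to vanish.\<close>

lemma extreme_points: "{v. v extreme_point_of (convex hull V)} = V"
proof (intro subset_antisym subsetI, unfold mem_Collect_eq)
  fix y assume y: "y \<in> V"
  show "y extreme_point_of (convex hull V)"
    unfolding extreme_point_of_def
  proof (intro conjI ballI notI)
    show "y \<in> convex hull V" using y by (simp add: hull_inc)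
    fix a b assume ab: "a \<in> convex hull V" "b \<in> convex hull V" "y \<in> open_segment a b"
    then obtain t where t: "0 < t" "t < 1" "y = (1 - t) *\<^sub>R a + t *\<^sub>R b" and ne: "a \<noteq> b"
      by (auto simp: in_segment)
    have "a - b = 0"
    proof (rule active[OF y])
      show "a - b \<in> S" using ab hull_V subspace_S by (auto intro: subspace_diff)
      fix u assume u: "u \<in> V" "y \<bullet> u = -1"
      have eq: "(1 - t) * (a \<bullet> u + 1) + t * (b \<bullet> u + 1) = 0"
        using u(2) t(3) by (simp add: inner_add_left algebra_simps)
      have ge: "0 \<le> a \<bullet> u + 1" "0 \<le> b \<bullet> u + 1"
        using inner_ge[OF ab(1) u(1)] inner_ge[OF ab(2) u(1)] by auto
      have "(1 - t) * (a \<bullet> u + 1) = 0 \<and> t * (b \<bullet> u + 1) = 0"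
        using eq ge t by (subst add_nonneg_eq_0_iff[symmetric]) auto
      then show "(a - b) \<bullet> u = 0" using t by (simp add: inner_diff_left)
    qed
    then show False using ne by simp
  qed
qed (simp add: extreme_point_of_convex_hull)

end

section \<open>Simple vertices and their dual bases\<close>

text \<open>The vertex \<open>v\<close> lies on exactly the facets dual to \<open>u 0, \<dots>, u (D - 1)\<close>, and \<open>w i\<close> is its
  neighbour along the edge that leaves the facet dual to \<open>u i\<close>. The dimension of \<open>S\<close> is forced
  to be \<open>D\<close>, because the edge directions are dual to the \<open>u i\<close> up to scaling.\<close>

locale simple_vertex = neg_self_polar S V for S V :: "'a::euclidean_space set" +
  fixes D :: nat and v :: 'a and u w :: "nat \<Rightarrow> 'a"
  assumes v_in: "v \<in> V"
    and u_in: "i < D \<Longrightarrow> u i \<in> V"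
    and w_in: "i < D \<Longrightarrow> w i \<in> V"
    and vu: "i < D \<Longrightarrow> v \<bullet> u i = -1"
    and wu: "\<lbrakk>i < D; j < D; i \<noteq> j\<rbrakk> \<Longrightarrow> w i \<bullet> u j = -1"
    and wu_self: "i < D \<Longrightarrow> -1 < w i \<bullet> u i"
    and u_separate: "\<lbrakk>z \<in> S; \<And>i. i < D \<Longrightarrow> z \<bullet> u i = 0\<rbrakk> \<Longrightarrow> z = 0"
begin

definition e :: "nat \<Rightarrow> 'a" where "e i = w i - v"

lemma e_in: "i < D \<Longrightarrow> e i \<in> S"
  unfolding e_def by (intro subspace_diff subspace_S V_in_S w_in v_in)

lemma eu: "\<lbrakk>i < D; j < D; i \<noteq> j\<rbrakk> \<Longrightarrow> e i \<bullet> u j = 0"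
  by (simp add: e_def inner_diff_left wu vu)

lemma eu_self: "i < D \<Longrightarrow> 0 < e i \<bullet> u i"
  using wu_self[of i] by (simp add: e_def inner_diff_left vu)

lemma sum_single:
  fixes f :: "nat \<Rightarrow> real"
  assumes "j < D" and "\<And>i. \<lbrakk>i < D; i \<noteq> j\<rbrakk> \<Longrightarrow> f i = 0"
  shows "(\<Sum>i<D. f i) = f j"
  using assms by (subst sum.remove[of _ j]) auto

text \<open>The families \<open>e\<close> and \<open>u\<close> are biorthogonal up to positive
  factors, so the difference of the two sides is orthogonal to every \<open>u i\<close>.\<close>

lemma expand_e:
  assumes "z \<in> S"
  shows "z = (\<Sum>i<D. (z \<bullet> u i / (e i \<bullet> u i)) *\<^sub>R e i)" (is "z = ?r")
proof -
  have "z - ?r = 0"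
  proof (rule u_separate)
    show "z - ?r \<in> S"
      by (intro subspace_diff subspace_S assms subspace_sum subspace_scale) (simp add: e_in)
    fix j assume j: "j < D"
    have "?r \<bullet> u j = (z \<bullet> u j / (e j \<bullet> u j)) * (e j \<bullet> u j)"
      unfolding inner_sum_left inner_scaleR_left by (rule sum_single) (auto simp: j eu)
    then show "(z - ?r) \<bullet> u j = 0"
      using eu_self[OF j] by (simp add: inner_diff_left)
  qed
  then show ?thesis by simp
qed

lemma e_separate:
  assumes "z \<in> S" and "\<And>i. i < D \<Longrightarrow> z \<bullet> e i = 0"
  shows "z = 0"
proof -
  have "z \<bullet> z = z \<bullet> (\<Sum>i<D. (z \<bullet> u i / (e i \<bullet> u i)) *\<^sub>R e i)"
    using expand_e[OF assms(1)] by simp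
  also have "\<dots> = 0" by (simp add: inner_sum_right assms(2))
  finally show ?thesis by simp
qed

lemma expand_u:
  assumes "z \<in> S"
  shows "z = (\<Sum>i<D. (z \<bullet> e i / (e i \<bullet> u i)) *\<^sub>R u i)" (is "z = ?r")
proof -
  have "z - ?r = 0"
  proof (rule e_separate)
    show "z - ?r \<in> S"
      by (intro subspace_diff subspace_S assms subspace_sum subspace_scale)
        (simp add: V_in_S u_in)
    fix j assume j: "j < D"
    have "?r \<bullet> e j = (z \<bullet> e j / (e j \<bullet> u j)) * (u j \<bullet> e j)"
      unfolding inner_sum_left inner_scaleR_left
      by (rule sum_single) (auto simp: j eu inner_commute[of "u _"])
    then show "(z - ?r) \<bullet> e j = 0"
      using eu_self[OF j] by (simp add: inner_diff_left inner_commute[of "u j"])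
  qed
  then show ?thesis by simp
qed

text \<open>Up to positive factors, the coefficients are the slacks of \<open>y\<close> at the
  facets dual to the \<open>u i\<close>.\<close>

lemma cone_at_v:
  assumes "y \<in> convex hull V"
  obtains c where "\<And>i. i < D \<Longrightarrow> 0 \<le> c i" "y = v + (\<Sum>i<D. c i *\<^sub>R e i)"
proof
  let ?c = "\<lambda>i. (y - v) \<bullet> u i / (e i \<bullet> u i)"
  have "y - v \<in> S" using assms hull_V subspace_S V_in_S[OF v_in] by (auto intro: subspace_diff)
  from expand_e[OF this] show "y = v + (\<Sum>i<D. ?c i *\<^sub>R e i)" by (simp add: algebra_simps)
  fix i assume "i < D"
  then show "0 \<le> ?c i"
    using inner_ge[OF assms u_in, of i] eu_self[of i] by (simp add: inner_diff_left vu)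
qed

end

section \<open>Adding a point and cutting off a simple vertex\<close>

text \<open>Add-and-cut: \<open>x\<close> is placed beyond the facet dual to \<open>v\<close> only, so its dual halfspace cuts off
  \<open>v\<close> only, and \<open>q i\<close> is where the new facet meets the edge from \<open>v\<close> to \<open>w i\<close>.\<close>

locale vertex_cut = simple_vertex S V D v u w
  for S V :: "'a::euclidean_space set" and D v u w +
  fixes x :: 'a
  assumes D_ge: "2 \<le> D"
    and x_in: "x \<in> S"
    and xv: "x \<bullet> v < -1"
    and xp: "\<lbrakk>p \<in> V; p \<noteq> v\<rbrakk> \<Longrightarrow> -1 < x \<bullet> p"
begin

text \<open>\<open>\<delta>\<close> is the amount by which \<open>v\<close> violates the constraint
  of \<open>x\<close>; along \<open>e i\<close> this is made up at parameter
  \<open>\<tau> i\<close>, which places \<open>q i\<close> on the cutting hyperplane.\<close>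

definition \<delta> :: real where "\<delta> = -1 - x \<bullet> v"
definition \<tau> :: "nat \<Rightarrow> real" where "\<tau> i = \<delta> / (x \<bullet> e i)"
definition q :: "nat \<Rightarrow> 'a" where "q i = v + \<tau> i *\<^sub>R e i"
definition V' :: "'a set" where "V' = insert x (V - {v} \<union> q ` {..<D})"

lemma \<delta>_pos: "0 < \<delta>"
  using xv by (simp add: \<delta>_def)

lemma w_ne: "i < D \<Longrightarrow> w i \<noteq> v"
  using wu_self[of i] vu[of i] by auto

lemma u_ne: "i < D \<Longrightarrow> u i \<noteq> v"
  using vu[of i] inner_self_ne_minus_one[of v] by auto

lemma xe: "i < D \<Longrightarrow> \<delta> < x \<bullet> e i"
  using xp[OF w_in w_ne, of i] by (simp add: e_def \<delta>_def inner_diff_right)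

lemma \<tau>_bounds: assumes "i < D" shows "0 < \<tau> i" "\<tau> i < 1"
  using xe[OF assms] \<delta>_pos by (auto simp: \<tau>_def)

lemma \<tau>_xe: "i < D \<Longrightarrow> \<tau> i * (x \<bullet> e i) = \<delta>"
  using xe[of i] \<delta>_pos by (simp add: \<tau>_def)

lemma q_inner: "q i \<bullet> p = (1 - \<tau> i) * (v \<bullet> p) + \<tau> i * (w i \<bullet> p)"
  by (simp add: q_def e_def inner_add_left inner_diff_left algebra_simps)

lemma q_in_hull: assumes "i < D" shows "q i \<in> convex hull V"
proof -
  have "q i = (1 - \<tau> i) *\<^sub>R v + \<tau> i *\<^sub>R w i" by (simp add: q_def e_def algebra_simps)
  then show ?thesis
    using \<tau>_bounds[OF assms] v_in w_in[OF assms]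
    by (simp add: convexD_alt hull_inc)
qed

lemma q_in: "i < D \<Longrightarrow> q i \<in> S"
  using q_in_hull hull_V by auto

lemma qx: "i < D \<Longrightarrow> q i \<bullet> x = -1"
  using \<tau>_xe[of i] by (simp add: q_def inner_add_left inner_commute[of "v" x] inner_commute[of "e i" x] \<delta>_def)

lemma qu: "\<lbrakk>i < D; j < D; i \<noteq> j\<rbrakk> \<Longrightarrow> q i \<bullet> u j = -1"
  by (simp add: q_def inner_add_left eu vu)

lemma qu_self: "i < D \<Longrightarrow> -1 < q i \<bullet> u i"
  using mult_pos_pos[OF \<tau>_bounds(1) eu_self, of i i] by (simp add: q_def inner_add_left vu)

text \<open>\<open>q i\<close> is interior to the edge from \<open>v\<close> to \<open>w i\<close>,
  so every constraint active there is active along the whole edge, and \<open>active\<close> fails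
  for the direction \<open>e i\<close>.\<close>

lemma q_notin: assumes "i < D" shows "q i \<notin> V"
proof
  assume q: "q i \<in> V"
  have "e i = 0"
  proof (rule active[OF q e_in[OF assms]])
    fix p assume p: "p \<in> V" "q i \<bullet> p = -1"
    have "(1 - \<tau> i) * (v \<bullet> p + 1) + \<tau> i * (w i \<bullet> p + 1) = 0"
      using p(2) by (simp add: q_inner algebra_simps)
    moreover have "0 \<le> v \<bullet> p + 1" "0 \<le> w i \<bullet> p + 1"
      using inner_ge_V[OF v_in p(1)] inner_ge_V[OF w_in[OF assms] p(1)] by auto
    ultimately have "(1 - \<tau> i) * (v \<bullet> p + 1) = 0 \<and> \<tau> i * (w i \<bullet> p + 1) = 0"
      using \<tau>_bounds[OF assms] by (subst add_nonneg_eq_0_iff[symmetric]) auto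
    then show "e i \<bullet> p = 0" using \<tau>_bounds[OF assms] by (simp add: e_def inner_diff_left)
  qed
  then show False using w_ne[OF assms] by (simp add: e_def)
qed

lemma x_notin: "x \<notin> V"
  using inner_ge_V[OF _ v_in, of x] xv by auto

lemma q_ne_x: "i < D \<Longrightarrow> q i \<noteq> x"
  using qx[of i] inner_self_ne_minus_one[of x] by auto

lemma inj_q: "inj_on q {..<D}"
proof (rule inj_onI)
  fix i j assume "i \<in> {..<D}" "j \<in> {..<D}" "q i = q j"
  then show "i = j" using qu[of j i] qu_self[of i] by fastforce
qed

lemma finite_V': "finite V'"
  unfolding V'_def using finite_V by simp

lemma card_V': "card V' = card V + D"
proof -
  have "card (V - {v} \<union> q ` {..<D}) = card (V - {v}) + card (q ` {..<D})"
    using finite_V q_notin by (intro card_Un_disjoint) auto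
  also have "\<dots> = card V - 1 + D"
    using finite_V v_in by (simp add: card_image[OF inj_q])
  finally have "card (V - {v} \<union> q ` {..<D}) = card V - 1 + D" .
  moreover have "x \<notin> V - {v} \<union> q ` {..<D}" using x_notin q_ne_x by fastforce
  moreover have "0 < card V" using v_in finite_V card_gt_0_iff by blast
  ultimately show ?thesis unfolding V'_def using finite_V by simp
qed

lemma V'_cases:
  assumes "p \<in> V'"
  obtains "p = x" | "p \<in> V" "p \<noteq> v" | i where "i < D" "p = q i"
  using assms by (auto simp: V'_def)

lemma V'_I: "x \<in> V'" "\<lbrakk>p \<in> V; p \<noteq> v\<rbrakk> \<Longrightarrow> p \<in> V'" "i < D \<Longrightarrow> q i \<in> V'"
  by (auto simp: V'_def)

lemma V'_subset: "V' \<subseteq> S"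
  using x_in V_in_S q_in by (auto simp: V'_def)

lemma q_V: assumes "i < D" "p \<in> V" shows "-1 \<le> q i \<bullet> p"
  by (rule inner_ge[OF q_in_hull]) fact+

text \<open>\<open>q j\<close> is a convex combination of the old vertices \<open>v\<close> and
  \<open>w j\<close>, for which \<open>q_V\<close> gives the bound.\<close>

lemma qq: assumes "i < D" "j < D" shows "-1 \<le> q i \<bullet> q j"
proof -
  have "0 \<le> q i \<bullet> v + 1" "0 \<le> q i \<bullet> w j + 1"
    using q_V[OF assms(1) v_in] q_V[OF assms(1) w_in[OF assms(2)]] by auto
  then have "0 \<le> (1 - \<tau> j) * (q i \<bullet> v + 1) + \<tau> j * (q i \<bullet> w j + 1)"
    using \<tau>_bounds[OF assms(2)] by simp
  also have "\<dots> = q i \<bullet> q j + 1"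
    by (simp add: q_inner[of j] inner_commute[of "q i"] algebra_simps)
  finally show ?thesis by simp
qed

lemma V'_pair: assumes "p \<in> V'" "p' \<in> V'" shows "-1 \<le> p \<bullet> p'"
  using assms(1)
proof (cases rule: V'_cases)
  case 1
  show ?thesis using assms(2)
    by (cases rule: V'_cases) (use 1 xp qx inner_ge_zero[of x] in \<open>auto simp: inner_commute intro: less_imp_le order_trans[of "-1" 0]\<close>)
next
  case 2
  show ?thesis using assms(2)
    by (cases rule: V'_cases) (use 2 xp q_V inner_ge_V in \<open>auto simp: inner_commute intro: less_imp_le\<close>)
next
  case (3 i)
  show ?thesis using assms(2)
    by (cases rule: V'_cases) (use 3 qx q_V qq in auto)
qed

lemma hull_V'_subset: "convex hull V' \<subseteq> {y \<in> S. \<forall>p\<in>V'. -1 \<le> y \<bullet> p}"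
  using subspace_S V'_subset V'_pair by (rule hull_subset_if_pairwise)

text \<open>The cone at \<open>v\<close> meets the cutting hyperplane exactly in the hull of the points \<open>q i\<close>. So a
  segment from \<open>v\<close> to \<open>p\<close> enters the halfspace of \<open>x\<close> at the point \<open>r\<close> of this hull.\<close>

lemma cut_part:
  assumes y: "y \<in> convex hull V" and yx: "-1 \<le> y \<bullet> x"
  shows "y \<in> convex hull V'"
proof -
  have "u 0 \<in> V - {v}" using D_ge u_in u_ne by auto
  then have "V - {v} \<noteq> {}" by blast
  moreover have "y \<in> convex hull insert v (V - {v})" using y v_in by (simp only: insert_Diff)
  ultimately obtain s p where s: "0 \<le> s" "s \<le> 1" and p: "p \<in> convex hull (V - {v})"
    and yp: "y = (1 - s) *\<^sub>R v + s *\<^sub>R p"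
    unfolding convex_hull_insert_alt by (auto split: if_splits)
  have p': "p \<in> convex hull V'" using p hull_mono[of "V - {v}" V'] by (auto simp: V'_def)
  have "p \<in> convex hull V" using p hull_mono[of "V - {v}" V] by auto
  then obtain c where c: "\<And>i. i < D \<Longrightarrow> 0 \<le> c i" and pc: "p = v + (\<Sum>i<D. c i *\<^sub>R e i)"
    using cone_at_v by blast
  \<comment> \<open>\<open>\<delta> * C\<close> is the gain of \<open>x\<close> from
    \<open>v\<close> to \<open>p\<close>, so the segment from \<open>v\<close> to \<open>p\<close>
    meets the cutting hyperplane at parameter \<open>1 / C\<close>.\<close>
  define C where "C = (\<Sum>i<D. c i / \<tau> i)"
  have Cx: "(\<Sum>i<D. c i * (e i \<bullet> x)) = \<delta> * C"
    unfolding C_def sum_distrib_left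
  proof (rule sum.cong)
    fix i assume "i \<in> {..<D}"
    then show "c i * (e i \<bullet> x) = \<delta> * (c i / \<tau> i)"
      using \<tau>_xe[of i] \<tau>_bounds[of i] by (simp add: inner_commute field_simps)
  qed simp
  have "y \<bullet> x = v \<bullet> x + s * (\<delta> * C)"
    by (simp add: yp pc inner_add_left inner_sum_left Cx algebra_simps)
  then have "\<delta> * 1 \<le> \<delta> * (s * C)" using yx by (simp add: \<delta>_def inner_commute algebra_simps)
  then have sC: "1 \<le> s * C" using \<delta>_pos by simp
  then have s0: "0 < s" using s by (cases "s = 0") auto
  have C0: "0 < C" using sC s0 by (smt (verit) zero_less_mult_pos)
  define r where "r = v + (1 / C) *\<^sub>R (p - v)"
  have weights: "(\<Sum>i<D. c i / \<tau> i / C) = 1"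
    using C0 by (simp only: sum_divide_distrib[symmetric] C_def[symmetric]) simp
  have "r = (\<Sum>i<D. (c i / \<tau> i / C) *\<^sub>R q i)"
  proof -
    have "(\<Sum>i<D. (c i / \<tau> i / C) *\<^sub>R q i)
        = (\<Sum>i<D. (c i / \<tau> i / C) *\<^sub>R v) + (\<Sum>i<D. (1 / C) *\<^sub>R (c i *\<^sub>R e i))"
      unfolding sum.distrib[symmetric]
    proof (rule sum.cong)
      fix i assume "i \<in> {..<D}"
      then have "\<tau> i \<noteq> 0" using \<tau>_bounds[of i] by auto
      then show "(c i / \<tau> i / C) *\<^sub>R q i = (c i / \<tau> i / C) *\<^sub>R v + (1 / C) *\<^sub>R (c i *\<^sub>R e i)"
        by (simp add: q_def scaleR_add_right)
    qed simp
    also have "(\<Sum>i<D. (c i / \<tau> i / C) *\<^sub>R v) = v"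
      by (simp only: scaleR_sum_left[symmetric] weights scaleR_one)
    finally show ?thesis by (simp add: r_def pc scaleR_sum_right)
  qed
  moreover have "(\<Sum>i<D. (c i / \<tau> i / C) *\<^sub>R q i) \<in> convex hull V'"
  proof (rule convex_sum)
    show "(\<Sum>i<D. c i / \<tau> i / C) = 1" by (rule weights)
    show "0 \<le> c i / \<tau> i / C" if "i \<in> {..<D}" for i
      using that c[of i] \<tau>_bounds[of i] C0 by simp
    show "q i \<in> convex hull V'" if "i \<in> {..<D}" for i
      using that V'_I(3)[of i] by (simp add: hull_inc)
  qed auto
  ultimately have r: "r \<in> convex hull V'" by simp
  have "1 / C \<le> s" using sC C0 by (simp add: field_simps)
  show ?thesis
  proof (cases "s = 1")
    case True
    then show ?thesis using yp p' by simp
  next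
    case False
    \<comment> \<open>On that segment \<open>r\<close>, \<open>y\<close> and \<open>p\<close> have
      parameters \<open>1 / C\<close>, \<open>s\<close> and 1; \<open>l\<close> is the position of
      \<open>y\<close> between \<open>r\<close> and \<open>p\<close>. Excluding \<open>s = 1\<close>
      makes the denominator positive.\<close>
    define l where "l = (s - 1 / C) / (1 - 1 / C)"
    have d: "0 < 1 - 1 / C" using \<open>1 / C \<le> s\<close> False s by linarith
    have l: "0 \<le> l" "l \<le> 1" using d \<open>1 / C \<le> s\<close> s by (auto simp: l_def)
    have leq: "(1 - l) / C + l = s"
    proof -
      have "l * (1 - 1 / C) = s - 1 / C"
        unfolding l_def by (rule nonzero_eq_divide_eq[THEN iffD1, OF _ refl]) (use d in linarith)
      then show ?thesis by (simp add: algebra_simps diff_divide_distrib)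
    qed
    have "(1 - l) *\<^sub>R r + l *\<^sub>R p = v + ((1 - l) / C + l) *\<^sub>R (p - v)"
      by (simp add: r_def algebra_simps diff_divide_distrib)
    also have "\<dots> = y" unfolding leq by (simp add: yp algebra_simps)
    finally show ?thesis
      using convexD_alt[OF convex_convex_hull r p', of l] l by simp
  qed
qed

text \<open>Subtracting the multiple of \<open>x\<close> for which the homogenised remainder \<open>(z, 1 - t)\<close> is
  orthogonal to \<open>(v, 1)\<close> leaves a nonnegative combination of the \<open>u i\<close>.\<close>

lemma new_part:
  assumes yS: "y \<in> S" and yp: "\<And>p. p \<in> V' \<Longrightarrow> -1 \<le> y \<bullet> p" and yv: "y \<bullet> v < -1"
  shows "y \<in> convex hull V'"
proof -
  define \<eta> where "\<eta> = -1 - y \<bullet> v"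
  define t where "t = \<eta> / \<delta>"
  define z where "z = y - t *\<^sub>R x"
  define c where "c = (\<lambda>i. z \<bullet> e i / (e i \<bullet> u i))"
  have t: "0 \<le> t" using yv \<delta>_pos by (simp add: t_def \<eta>_def)
  have td: "t * \<delta> = \<eta>" using \<delta>_pos by (simp add: t_def)
  have zS: "z \<in> S" unfolding z_def by (intro subspace_diff subspace_scale subspace_S yS x_in)
  \<comment> \<open>The choice of \<open>t\<close> turns the constraint on \<open>y\<close> at
    \<open>q i\<close> into nonnegativity of \<open>z\<close> on \<open>e i\<close>.\<close>
  have c0: "0 \<le> c i" if i: "i < D" for i
  proof -
    have "\<eta> \<le> \<tau> i * (y \<bullet> e i)"
      using yp[OF V'_I(3)[OF i]] by (simp add: q_def inner_add_right \<eta>_def)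
    also have "\<dots> = \<tau> i * (z \<bullet> e i) + t * (\<tau> i * (x \<bullet> e i))"
      by (simp add: z_def inner_diff_left algebra_simps)
    finally have "0 \<le> \<tau> i * (z \<bullet> e i)" using \<tau>_xe[OF i] td by simp
    then have "0 \<le> z \<bullet> e i" using \<tau>_bounds[OF i] by (simp add: zero_le_mult_iff)
    then show ?thesis using eu_self[OF i] by (simp add: c_def)
  qed
  have zc: "z = (\<Sum>i<D. c i *\<^sub>R u i)" unfolding c_def by (rule expand_u[OF zS])
  have "z \<bullet> v = - (\<Sum>i<D. c i)"
    unfolding zc inner_sum_left sum_negf[symmetric]
    by (rule sum.cong) (auto simp: vu inner_commute)
  moreover have "z \<bullet> v = -1 + t"
  proof -
    have "z \<bullet> v = -1 - \<eta> + t * (1 + \<delta>)" by (simp add: z_def \<eta>_def \<delta>_def inner_diff_left)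
    then show ?thesis using td by (simp add: algebra_simps)
  qed
  ultimately have csum: "(\<Sum>i<D. c i) = 1 - t" by simp
  \<comment> \<open>Index \<open>D\<close> carries the extra point \<open>x\<close> with weight
    \<open>t\<close>, which brings the total weight to 1.\<close>
  define f where "f = (\<lambda>i. if i < D then u i else x)"
  define g where "g = (\<lambda>i. if i < D then c i else t)"
  have "(\<Sum>i<Suc D. g i *\<^sub>R f i) \<in> convex hull V'"
  proof (rule convex_sum)
    show "(\<Sum>i<Suc D. g i) = 1" using csum by (simp add: g_def)
    show "0 \<le> g i" for i using c0 t by (simp add: g_def)
    show "f i \<in> convex hull V'" for i using V'_I u_in u_ne by (simp add: f_def hull_inc)
  qed auto
  moreover have "(\<Sum>i<Suc D. g i *\<^sub>R f i) = y"
    using zc by (simp add: g_def f_def z_def algebra_simps)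
  ultimately show ?thesis by simp
qed

lemma hull_V': "convex hull V' = {y \<in> S. \<forall>p\<in>V'. -1 \<le> y \<bullet> p}"
proof (rule subset_antisym[OF hull_V'_subset], rule subsetI)
  fix y assume y: "y \<in> {y \<in> S. \<forall>p\<in>V'. -1 \<le> y \<bullet> p}"
  show "y \<in> convex hull V'"
  proof (cases "y \<bullet> v < -1")
    case True
    then show ?thesis using y new_part by simp
  next
    case False
    then have "-1 \<le> y \<bullet> p" if "p \<in> V" for p
      using y V'_I(2)[OF that] by (cases "p = v") auto
    then have "y \<in> convex hull V" using y by (simp add: hull_V)
    then show ?thesis using cut_part y V'_I(1) by simp
  qed
qed

text \<open>If no \<open>w k\<close> were active at \<open>y\<close>, then \<open>y\<close> would
  increase strictly along all edges at \<open>v\<close>, so \<open>v\<close> would be the only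
  active point. By \<open>active\<close>, no nonzero vector of \<open>S\<close> would be orthogonal
  to \<open>v\<close>, contradicting \<open>D_ge\<close>.\<close>

lemma old_neighbour:
  assumes y: "y \<in> V" "y \<bullet> v = -1"
  obtains k where "k < D" "y \<bullet> w k = -1"
proof (rule ccontr)
  assume "\<not> thesis"
  then have ne: "y \<bullet> w k \<noteq> -1" if "k < D" for k using that \<open>\<And>k. \<lbrakk>k < D; y \<bullet> w k = -1\<rbrakk> \<Longrightarrow> thesis\<close> by blast
  have ye: "0 < y \<bullet> e k" if "k < D" for k
    using ne[OF that] inner_ge_V[OF y(1) w_in[OF that]] y(2) by (simp add: e_def inner_diff_right)
  have only: "p = v" if p: "p \<in> V" "y \<bullet> p = -1" for p
  proof -
    obtain c where c: "\<And>i. i < D \<Longrightarrow> 0 \<le> c i" and pc: "p = v + (\<Sum>i<D. c i *\<^sub>R e i)"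
      using cone_at_v[OF hull_inc[OF p(1)]] by blast
    have "(\<Sum>i<D. c i * (y \<bullet> e i)) = 0"
      using p(2) y(2) by (simp add: pc inner_add_right inner_sum_right)
    then have "c i * (y \<bullet> e i) = 0" if "i < D" for i
      using that c ye by (subst (asm) sum_nonneg_eq_0_iff) (auto simp: less_imp_le)
    then have "c i = 0" if "i < D" for i using ye[OF that] that by fastforce
    then show ?thesis by (simp add: pc)
  qed
  have zero: "z = 0" if "z \<in> S" "z \<bullet> v = 0" for z
    using active[OF y(1) that(1)] only that(2) by blast
  have D: "0 < D" "1 < D" using D_ge by auto
  \<comment> \<open>This combination of two edge directions is orthogonal to \<open>v\<close> by
    construction; pairing it with \<open>u 0\<close> isolates the coefficient of
    \<open>e 0\<close>.\<close>
  let ?z = "(e 1 \<bullet> v) *\<^sub>R e 0 - (e 0 \<bullet> v) *\<^sub>R e 1"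
  have "?z = 0"
    by (rule zero, intro subspace_diff subspace_scale subspace_S e_in D) (simp add: inner_diff_left)
  then have "?z \<bullet> u 0 = 0" by simp
  then have "e 1 \<bullet> v = 0" using eu[of 1 0] eu_self[of 0] D by (simp add: inner_diff_left)
  then have "e 1 = 0" using zero e_in[OF D(2)] by blast
  then show False using eu_self[of 1] D by simp
qed

lemma e_multiple:
  assumes "z \<in> S" "k < D" and "\<And>i. \<lbrakk>i < D; i \<noteq> k\<rbrakk> \<Longrightarrow> z \<bullet> u i = 0" and "z \<bullet> x = 0"
  shows "z = 0"
proof -
  have "z = (z \<bullet> u k / (e k \<bullet> u k)) *\<^sub>R e k"
  proof -
    have "(\<Sum>i<D. (z \<bullet> u i / (e i \<bullet> u i)) *\<^sub>R e i) = (z \<bullet> u k / (e k \<bullet> u k)) *\<^sub>R e k"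
      using assms(2,3) by (subst sum.remove[of _ k]) auto
    then show ?thesis using expand_e[OF assms(1)] by simp
  qed
  then obtain a where a: "z = a *\<^sub>R e k" by blast
  then show ?thesis using assms(4) xe[OF assms(2)] \<delta>_pos by (simp add: inner_commute)
qed

text \<open>Orthogonality to all \<open>q i\<close> makes
  \<open>\<delta> *\<^sub>R z + a *\<^sub>R x\<close> orthogonal to all edges, hence zero. Pairing
  with \<open>v\<close> then gives \<open>a = 0\<close>, because
  \<open>\<delta> + x \<bullet> v = -1\<close>.\<close>

lemma active_x:
  assumes z: "z \<in> S" and zq: "\<And>i. i < D \<Longrightarrow> z \<bullet> q i = 0"
  shows "z = 0"
proof -
  define a where "a = z \<bullet> v"
  have "\<delta> *\<^sub>R z + a *\<^sub>R x = 0"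
  proof (rule e_separate)
    show "\<delta> *\<^sub>R z + a *\<^sub>R x \<in> S" by (intro subspace_add subspace_scale subspace_S z x_in)
    fix i assume i: "i < D"
    have "a + \<tau> i * (z \<bullet> e i) = 0" using zq[OF i] by (simp add: q_def inner_add_right a_def)
    then have "(x \<bullet> e i) * a + (\<tau> i * (x \<bullet> e i)) * (z \<bullet> e i) = 0" by algebra
    then show "(\<delta> *\<^sub>R z + a *\<^sub>R x) \<bullet> e i = 0"
      using \<tau>_xe[OF i] by (simp add: inner_add_left algebra_simps)
  qed
  moreover from this have "(\<delta> *\<^sub>R z + a *\<^sub>R x) \<bullet> v = 0" by simp
  then have "a * (\<delta> + x \<bullet> v) = 0" by (simp add: inner_add_left a_def algebra_simps)
  then have "a = 0" by (simp add: \<delta>_def)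
  ultimately show ?thesis using \<delta>_pos by simp
qed

text \<open>Only old vertices active at \<open>v\<close> lose a constraint. For these, some
  \<open>w k\<close> and \<open>q k\<close> are active, and \<open>v\<close> lies on the line
  through them.\<close>

lemma active_V':
  assumes y: "y \<in> V'" and z: "z \<in> S" and zp: "\<And>p. \<lbrakk>p \<in> V'; y \<bullet> p = -1\<rbrakk> \<Longrightarrow> z \<bullet> p = 0"
  shows "z = 0"
  using y
proof (cases rule: V'_cases)
  case 1
  show ?thesis
  proof (rule active_x[OF z])
    fix i assume "i < D"
    then show "z \<bullet> q i = 0" using zp[OF V'_I(3)] 1 qx by (simp add: inner_commute[of x])
  qed
next
  case 2
  show ?thesis
  proof (rule active[OF 2(1) z])
    fix p assume p: "p \<in> V" "y \<bullet> p = -1"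
    show "z \<bullet> p = 0"
    proof (cases "p = v")
      case False
      then show ?thesis using zp V'_I(2) p by simp
    next
      case True
      then obtain k where k: "k < D" "y \<bullet> w k = -1" using old_neighbour 2(1) p by metis
      have "z \<bullet> w k = 0" using zp V'_I(2) w_in w_ne k by blast
      moreover have "y \<bullet> q k = -1" using k True p(2) q_inner[of k y]
        by (simp add: inner_commute algebra_simps)
      then have "z \<bullet> q k = 0" using zp V'_I(3)[OF k(1)] by simp
      ultimately have "(1 - \<tau> k) * (z \<bullet> v) = 0"
        using q_inner[of k z] by (simp add: inner_commute)
      then show ?thesis using \<tau>_bounds[OF k(1)] True by simp
    qed
  qed
next
  case (3 k)
  show ?thesis
  proof (rule e_multiple[OF z 3(1)])
    show "z \<bullet> x = 0" using zp V'_I(1) 3 qx by simp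
    fix i assume "i < D" "i \<noteq> k"
    then show "z \<bullet> u i = 0" using zp V'_I(2)[OF u_in u_ne] 3 qu by auto
  qed
qed

text \<open>At \<open>q 0\<close> the new facet dual to \<open>x\<close> replaces the one dual to
  \<open>u 0\<close>. The edge leaving it ends at the old vertex \<open>w 0\<close>; the other edges
  run inside it to the \<open>q i\<close>.\<close>

lemma simple_vertex_V':
  "simple_vertex S V' D (q 0) (\<lambda>i. if i = 0 then x else u i) (\<lambda>i. if i = 0 then w 0 else q i)"
\<comment> \<open>The goals follow the order of the locale axioms: 5 is \<open>active\<close>, 10 is
  \<open>wu\<close>, 11 is \<open>wu_self\<close> and 12 is \<open>u_separate\<close>.\<close>
proof (unfold_locales, goal_cases)
  case (12 z)
  have "z \<bullet> x = 0" using 12(2)[of 0] D_ge by simp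
  moreover have "z \<bullet> u i = 0" if "i < D" "i \<noteq> 0" for i using 12(2)[of i] that by simp
  ultimately show ?case using e_multiple[of z 0] 12(1) D_ge by auto
next
  case (5 y z)
  then show ?case using active_V' by blast
next
  case (10 i j)
  then show ?case using qx qu wu by (auto simp: inner_commute)
next
  case (11 i)
  then show ?case using qu_self xp[OF w_in w_ne] by (auto simp: inner_commute)
qed (use subspace_S finite_V' V'_subset hull_V' V'_I D_ge u_in u_ne w_in w_ne qx qu in auto)

end

lemma (in simple_vertex) obtain_cut:
  assumes "2 \<le> D"
  obtains x where "vertex_cut S V D v u w x"
proof -
  \<comment> \<open>The barycentre of the \<open>u i\<close> lies on the facet dual to
    \<open>v\<close> and on no other: by \<open>u_separate\<close>, only \<open>v\<close> is active
    at all \<open>u i\<close>.\<close>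
  define c where "c = (1 / real D) *\<^sub>R (\<Sum>i<D. u i)"
  have cS: "c \<in> S"
    unfolding c_def by (intro subspace_scale subspace_sum subspace_S) (simp add: V_in_S u_in)
  have c: "c \<bullet> p + 1 = (\<Sum>i<D. u i \<bullet> p + 1) / D" for p
    using assms by (simp add: c_def inner_sum_left sum.distrib add_divide_distrib)
  have cv: "c \<bullet> v = -1"
    using c[of v] by (simp add: inner_commute[of _ v] vu)
  have cp: "-1 < c \<bullet> p" if p: "p \<in> V" "p \<noteq> v" for p
  proof -
    obtain i where i: "i < D" "(p - v) \<bullet> u i \<noteq> 0"
      using u_separate[of "p - v"] p V_in_S v_in subspace_diff[OF subspace_S] by auto
    have ge: "0 \<le> u j \<bullet> p + 1" if "j < D" for j using inner_ge_V[OF u_in[OF that] p(1)] by simp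
    have "u i \<bullet> p + 1 \<noteq> 0" using i by (simp add: inner_diff_left vu inner_commute[of "u i"])
    then have "0 < (\<Sum>i<D. u i \<bullet> p + 1)"
      using ge i(1) by (intro sum_pos2[of _ i]) (auto simp: less_le)
    then have "0 < c \<bullet> p + 1" unfolding c using assms by simp
    then show ?thesis by simp
  qed
  \<comment> \<open>Inserting 0 makes the maximum meaningful for an empty image and ensures
    \<open>0 \<le> b\<close>.\<close>
  define b where "b = Max (insert 0 ((\<lambda>p. - (c \<bullet> p)) ` (V - {v})))"
  have b: "0 \<le> b" "b < 1" "\<And>p. \<lbrakk>p \<in> V; p \<noteq> v\<rbrakk> \<Longrightarrow> - (c \<bullet> p) \<le> b"
    unfolding b_def using finite_V cp by (auto intro!: Max_ge simp: less_le_not_le[of "- _"])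
  \<comment> \<open>\<open>1 / s\<close> is the midpoint of \<open>b\<close> and 1, so scaling by
    \<open>s\<close> crosses the facet dual to \<open>v\<close> but reaches no other.\<close>
  define s where "s = 2 / (1 + b)"
  have s: "1 < s" "s * b < 1" using b by (auto simp: s_def field_simps)
  show ?thesis
  proof (rule that[of "s *\<^sub>R c"], unfold_locales)
    show "s *\<^sub>R c \<in> S" using cS by (rule subspace_scale[OF subspace_S])
    show "s *\<^sub>R c \<bullet> v < -1" using s by (simp add: cv)
    fix p assume p: "p \<in> V" "p \<noteq> v"
    have "s * - (c \<bullet> p) \<le> s * b" using b(3)[OF p] s by (intro mult_left_mono) auto
    then show "-1 < s *\<^sub>R c \<bullet> p" using s by simp
  qed (rule assms)
qed

section \<open>Pyramids\<close>

locale pyramid = simple_vertex S V D v u w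
  for S V :: "'a::euclidean_space set" and D v u w +
  fixes b :: 'a
  assumes b_unit: "b \<bullet> b = 1"
    and b_orth: "s \<in> S \<Longrightarrow> s \<bullet> b = 0"
begin

text \<open>The base sits at height -1 below the apex \<open>b\<close>. The factor
  \<open>sqrt 2\<close> gives lifted points the inner product
  \<open>2 * (s \<bullet> p) + 1\<close>, which equals -1 exactly when \<open>s \<bullet> p\<close>
  does.\<close>

definition lift :: "'a \<Rightarrow> 'a" where "lift s = sqrt 2 *\<^sub>R s - b"
definition S' :: "'a set" where "S' = {x. \<exists>t. x - t *\<^sub>R b \<in> S}"
definition V' :: "'a set" where "V' = insert b (lift ` V)"

lemma S'_cases:
  assumes "y \<in> S'"
  obtains s t where "s \<in> S" "y = s + t *\<^sub>R b"
proof -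
  from assms obtain t where "y - t *\<^sub>R b \<in> S" by (auto simp: S'_def)
  then show ?thesis using that[of "y - t *\<^sub>R b" t] by simp
qed

lemma S'_I: "s \<in> S \<Longrightarrow> s + t *\<^sub>R b \<in> S'"
  by (auto simp: S'_def intro!: exI[of _ t])

lemma subspace_S': "subspace S'"
proof -
  have "span S = S" using subspace_S by (simp only: span_eq_iff)
  then have "span (insert b S) = S'" by (simp only: S'_def span_insert)
  then show ?thesis by (metis subspace_span)
qed

lemma b_in: "b \<in> S'"
  using S'_I[of 0 1] subspace_0[OF subspace_S] by simp

lemma lift_in: "s \<in> S \<Longrightarrow> lift s \<in> S'"
  using S'_I[of "sqrt 2 *\<^sub>R s" "-1"] subspace_scale[OF subspace_S] by (simp add: lift_def)

lemma inner_lift: "\<lbrakk>s \<in> S; p \<in> S\<rbrakk> \<Longrightarrow> (s + t *\<^sub>R b) \<bullet> lift p = sqrt 2 * (s \<bullet> p) - t"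
  by (simp add: lift_def inner_add_left inner_diff_right b_unit b_orth inner_commute[of b p])

lemma inner_b: "s \<in> S \<Longrightarrow> (s + t *\<^sub>R b) \<bullet> b = t"
  by (simp add: inner_add_left b_unit b_orth)

lemma lift_lift: "\<lbrakk>s \<in> S; p \<in> S\<rbrakk> \<Longrightarrow> lift s \<bullet> lift p = 2 * (s \<bullet> p) + 1"
  using inner_lift[of "sqrt 2 *\<^sub>R s" p "-1"] subspace_scale[OF subspace_S]
  by (simp add: lift_def)

lemma lift_b: "s \<in> S \<Longrightarrow> lift s \<bullet> b = -1"
  by (simp add: lift_def inner_diff_left b_unit b_orth)

lemma V'_I: "b \<in> V'" "p \<in> V \<Longrightarrow> lift p \<in> V'"
  by (auto simp: V'_def)

lemma V'_subset: "V' \<subseteq> S'"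
  using b_in lift_in V_in_S by (auto simp: V'_def)

lemma inj_lift: "inj_on lift V"
  by (auto simp: inj_on_def lift_def)

lemma card_V': "card V' = card V + 1"
proof -
  have "b \<notin> lift ` V" using lift_b V_in_S b_unit by force
  then show ?thesis using finite_V by (simp add: V'_def card_image[OF inj_lift])
qed

lemma V'_pair: assumes "p \<in> V'" "p' \<in> V'" shows "-1 \<le> p \<bullet> p'"
proof -
  have "-1 \<le> lift y \<bullet> lift y'" if "y \<in> V" "y' \<in> V" for y y'
    using inner_ge_V[OF that] that by (simp add: lift_lift V_in_S)
  moreover have "lift y \<bullet> b = -1" "b \<bullet> lift y = -1" if "y \<in> V" for y
    using lift_b[OF V_in_S[OF that]] by (simp_all add: inner_commute)
  ultimately show ?thesis using assms b_unit by (auto simp: V'_def)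
qed

lemma hull_V'_subset: "convex hull V' \<subseteq> {y \<in> S'. \<forall>p\<in>V'. -1 \<le> y \<bullet> p}"
  using subspace_S' V'_subset V'_pair by (rule hull_subset_if_pairwise)

lemma lift_hull: "s \<in> convex hull V \<Longrightarrow> lift s \<in> convex hull V'"
proof -
  assume s: "s \<in> convex hull V"
  have "lift = (\<lambda>x. - b + sqrt 2 *\<^sub>R x)" by (auto simp: lift_def)
  then have "convex hull (lift ` V) = lift ` (convex hull V)"
    using convex_hull_affinity[of "- b" "sqrt 2" V] by simp
  then have "lift s \<in> convex hull (lift ` V)" using s by auto
  then show ?thesis using hull_mono[of "lift ` V" V'] by (auto simp: V'_def)
qed

text \<open>Below height 1, rescaling the \<open>S\<close>-component of \<open>y\<close> gives a
  point \<open>s'\<close> of the old hull, and \<open>y\<close> lies between \<open>lift s'\<close>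
  and \<open>b\<close>. At height 1 or above, \<open>no_recession\<close> leaves only the
  apex.\<close>

lemma hull_V': "convex hull V' = {y \<in> S'. \<forall>p\<in>V'. -1 \<le> y \<bullet> p}"
proof (rule subset_antisym[OF hull_V'_subset], rule subsetI)
  fix y assume y: "y \<in> {y \<in> S'. \<forall>p\<in>V'. -1 \<le> y \<bullet> p}"
  then obtain s t where s: "s \<in> S" and yst: "y = s + t *\<^sub>R b" by (blast elim: S'_cases)
  have t: "-1 \<le> t" using y V'_I(1) inner_b[OF s, of t] yst by auto
  have sp: "t - 1 \<le> sqrt 2 * (s \<bullet> p)" if "p \<in> V" for p
    using y V'_I(2)[OF that] inner_lift[OF s V_in_S[OF that], of t] yst by fastforce
  show "y \<in> convex hull V'"
  proof (cases "t < 1")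
    case True
    define s' where "s' = (sqrt 2 / (1 - t)) *\<^sub>R s"
    have "s' \<in> convex hull V"
      using True s sp subspace_S by (auto simp: hull_V s'_def subspace_scale field_simps)
    then have "lift s' \<in> convex hull V'" by (rule lift_hull)
    moreover have "b \<in> convex hull V'" using V'_I(1) by (simp add: hull_inc)
    moreover define l where "l = (1 + t) / 2"
    moreover have "y = (1 - l) *\<^sub>R lift s' + l *\<^sub>R b"
    proof -
      have "(1 - l) * (sqrt 2 * (sqrt 2 / (1 - t))) = 1" "l - (1 - l) = t"
        using True by (simp_all add: l_def field_simps)
      moreover have "(1 - l) *\<^sub>R lift s' + l *\<^sub>R b
          = ((1 - l) * (sqrt 2 * (sqrt 2 / (1 - t)))) *\<^sub>R s + (l - (1 - l)) *\<^sub>R b"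
        by (simp only: lift_def s'_def scaleR_diff_right scaleR_scaleR
            scaleR_diff_left[of l "1 - l"] diff_add_eq add_diff_eq)
      ultimately show ?thesis using yst by (simp only: scaleR_one)
    qed
    ultimately show ?thesis
      using convexD_alt[OF convex_convex_hull, of "lift s'" V' b l] t True by simp
  next
    case False
    have "s = 0"
    proof (rule no_recession[OF s])
      fix p assume "p \<in> V"
      then have "0 \<le> sqrt 2 * (s \<bullet> p)" using sp[of p] False by linarith
      then show "0 \<le> s \<bullet> p" by (simp add: zero_le_mult_iff)
    qed
    moreover then have "t \<le> 1" using sp V_nonempty by auto
    ultimately have "y = b" using False yst by simp
    then show ?thesis using V'_I(1) by (simp add: hull_inc)
  qed
qed

text \<open>At the apex all lifted points are active, so \<open>s\<close> has constant inner product
  with \<open>V\<close>; then \<open>s\<close> or \<open>- s\<close> is a recession direction. At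
  \<open>lift p\<close> the active apex gives \<open>t = 0\<close>, and \<open>active\<close> at
  \<open>p\<close> does the rest.\<close>

lemma active_V':
  assumes y: "y \<in> V'" and z: "z \<in> S'" and zp: "\<And>p. \<lbrakk>p \<in> V'; y \<bullet> p = -1\<rbrakk> \<Longrightarrow> z \<bullet> p = 0"
  shows "z = 0"
proof -
  obtain s t where s: "s \<in> S" and zst: "z = s + t *\<^sub>R b" using z by (rule S'_cases)
  show ?thesis
  proof (cases "y = b")
    case True
    have st: "sqrt 2 * (s \<bullet> p) = t" if "p \<in> V" for p
      using zp[OF V'_I(2)[OF that]] lift_b[OF V_in_S[OF that]] True inner_lift[OF s V_in_S[OF that], of t]
      by (simp add: zst inner_commute[of b])
    have "s = 0"
    proof (cases "0 \<le> t")
      case True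
      have "0 \<le> s \<bullet> p" if "p \<in> V" for p
      proof -
        have "0 \<le> sqrt 2 * (s \<bullet> p)" using st[OF that] True by simp
        then show ?thesis by (simp add: zero_le_mult_iff)
      qed
      then show ?thesis using no_recession s by blast
    next
      case False
      have "0 \<le> (- s) \<bullet> p" if "p \<in> V" for p
      proof -
        have "sqrt 2 * (s \<bullet> p) < 0" using st[OF that] False by simp
        then show ?thesis by (simp add: mult_less_0_iff)
      qed
      then have "- s = 0" using no_recession s subspace_neg[OF subspace_S] by blast
      then show ?thesis by simp
    qed
    moreover from this have "t = 0" using st V_nonempty by auto
    ultimately show ?thesis by (simp add: zst)
  next
    case False
    then obtain p where p: "p \<in> V" "y = lift p" using y by (auto simp: V'_def)
    have t: "t = 0" using zp[OF V'_I(1)] lift_b[OF V_in_S[OF p(1)]] p inner_b[OF s, of t] zst by simp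
    have "s = 0"
    proof (rule active[OF p(1) s])
      fix r assume r: "r \<in> V" "p \<bullet> r = -1"
      then have "z \<bullet> lift r = 0" using zp V'_I(2) p lift_lift V_in_S by simp
      then show "s \<bullet> r = 0" using inner_lift[OF s V_in_S[OF r(1)], of t] t zst by simp
    qed
    then show ?thesis by (simp add: zst t)
  qed
qed

text \<open>The additional index \<open>D\<close> stands for the base, which is the facet dual to
  \<open>b\<close>; the edge leaving it ends at the apex, again \<open>b\<close>.\<close>

lemma simple_vertex_V':
  "simple_vertex S' V' (Suc D) (lift v) (\<lambda>i. if i < D then lift (u i) else b) (\<lambda>i. if i < D then lift (w i) else b)"
proof (unfold_locales, goal_cases)
  case (12 z)
  obtain s t where s: "s \<in> S" and zst: "z = s + t *\<^sub>R b" using 12(1) by (rule S'_cases)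
  have "t = 0" using 12(2)[of D] inner_b[OF s, of t] by (simp add: zst)
  moreover have "s = 0"
  proof (rule u_separate[OF s])
    fix i assume i: "i < D"
    have "z \<bullet> lift (u i) = 0" using 12(2)[of i] i by simp
    then show "s \<bullet> u i = 0"
      using inner_lift[OF s V_in_S[OF u_in[OF i]], of t] \<open>t = 0\<close> by (simp add: zst)
  qed
  ultimately show ?case by (simp add: zst)
next
  case (5 y z)
  then show ?case using active_V' by blast
next
  case (7 i)
  show ?case using V'_I u_in by simp
next
  case (8 i)
  show ?case using V'_I w_in by simp
next
  case (9 i)
  then show ?case using vu[of i] lift_lift[OF V_in_S V_in_S, OF v_in u_in, of i] lift_b[OF V_in_S[OF v_in]] by simp
next
  case (10 i j)
  have "lift (w i) \<bullet> lift (u j) = -1" if "i < D" "j < D"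
    using wu[OF that 10(3)] lift_lift[OF V_in_S V_in_S, OF w_in u_in, OF that] by simp
  moreover have "lift (w i) \<bullet> b = -1" if "i < D" using lift_b[OF V_in_S[OF w_in[OF that]]] .
  moreover have "b \<bullet> lift (u j) = -1" if "j < D"
    using lift_b[OF V_in_S[OF u_in[OF that]]] by (simp add: inner_commute)
  ultimately show ?case using 10 by auto
next
  case (11 i)
  show ?case
  proof (cases "i < D")
    case True
    then show ?thesis using wu_self[OF True] lift_lift[OF V_in_S V_in_S, OF w_in u_in, OF True True] by simp
  qed (simp add: b_unit)
next
  case 4
  show ?case by (rule hull_V')
qed (simp_all add: subspace_S' V'_subset V'_I v_in finite_V, simp add: V'_def finite_V)

end

section \<open>Attainable dimensions and vertex numbers\<close>

definition simple_vertex_polytope :: "'a::euclidean_space set \<Rightarrow> nat \<Rightarrow> nat \<Rightarrow> bool" where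
  "simple_vertex_polytope S D n \<longleftrightarrow> (\<exists>V v u w. simple_vertex S V D v u w \<and> card V = n)"

lemma simple_vertex_polytope_0: "simple_vertex_polytope {0} 0 1"
proof -
  have "simple_vertex {0::'a} {0} 0 0 (\<lambda>_. 0) (\<lambda>_. 0)"
    by unfold_locales auto
  then show ?thesis unfolding simple_vertex_polytope_def by fastforce
qed

lemma simple_vertex_polytope_cut:
  assumes "simple_vertex_polytope S D n" "2 \<le> D"
  shows "simple_vertex_polytope S D (n + D)"
proof -
  obtain V v u w where V: "simple_vertex S V D v u w" "card V = n"
    using assms(1) by (auto simp: simple_vertex_polytope_def)
  obtain x where "vertex_cut S V D v u w x"
    using simple_vertex.obtain_cut[OF V(1) assms(2)] .
  from vertex_cut.simple_vertex_V'[OF this] vertex_cut.card_V'[OF this] V(2)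
  show ?thesis unfolding simple_vertex_polytope_def by blast
qed

lemma simple_vertex_polytope_pyramid:
  assumes "simple_vertex_polytope (span B) D n" "b \<bullet> b = 1" "\<And>s. s \<in> B \<Longrightarrow> s \<bullet> b = 0"
  shows "simple_vertex_polytope (span (insert b B)) (Suc D) (Suc n)"
proof -
  obtain V v u w where V: "simple_vertex (span B) V D v u w" "card V = n"
    using assms(1) by (auto simp: simple_vertex_polytope_def)
  have orth: "s \<bullet> b = 0" if "s \<in> span B" for s
    using orthogonal_to_span[OF that, of b] assms(3)
    by (auto simp: orthogonal_def inner_commute[of b])
  interpret simple_vertex "span B" V D v u w by (rule V(1))
  interpret pyramid "span B" V D v u w b
    by unfold_locales (auto simp: assms(2) orth)
  have "S' = span (insert b B)" by (simp add: S'_def span_insert)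
  then show ?thesis using simple_vertex_V' card_V' V(2) unfolding simple_vertex_polytope_def by auto
qed

text \<open>Quantifying over all coordinate subspaces lets the pyramid step split off any basis
  vector. For \<open>k\<close> above the ambient dimension the condition is vacuous, so induction on
  \<open>k\<close> requires no bound.\<close>

definition coordinate_polytope :: "'a::euclidean_space itself \<Rightarrow> nat \<Rightarrow> nat \<Rightarrow> bool" where
  "coordinate_polytope _ k n \<longleftrightarrow>
     (\<forall>B \<subseteq> (Basis :: 'a set). card B = k \<longrightarrow> simple_vertex_polytope (span B) k n)"

lemma coordinate_polytope_0: "coordinate_polytope TYPE('a::euclidean_space) 0 1"
  unfolding coordinate_polytope_def
proof (intro allI impI)
  fix B :: "'a set" assume "B \<subseteq> Basis" "card B = 0"
  then have "B = {}" using finite_subset[OF _ finite_Basis, of B] by simp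
  then show "simple_vertex_polytope (span B) 0 1" using simple_vertex_polytope_0 by simp
qed

lemma coordinate_polytope_Suc:
  assumes "coordinate_polytope TYPE('a::euclidean_space) k n"
  shows "coordinate_polytope TYPE('a) (Suc k) (Suc n)"
  unfolding coordinate_polytope_def
proof (intro allI impI)
  fix B :: "'a set" assume B: "B \<subseteq> Basis" "card B = Suc k"
  then obtain b C where C: "B = insert b C" "b \<notin> C" "card C = k" by (metis card_Suc_eq)
  then have "simple_vertex_polytope (span C) k n"
    using assms B by (auto simp: coordinate_polytope_def)
  then show "simple_vertex_polytope (span B) (Suc k) (Suc n)"
    unfolding C(1)
  proof (rule simple_vertex_polytope_pyramid)
    show "b \<bullet> b = 1" using B C by auto
    show "s \<bullet> b = 0" if "s \<in> C" for s using B C that by (metis inner_not_same_Basis insert_subset subsetD)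
  qed
qed

lemma coordinate_polytope_cut:
  "\<lbrakk>coordinate_polytope TYPE('a::euclidean_space) k n; 2 \<le> k\<rbrakk>
    \<Longrightarrow> coordinate_polytope TYPE('a) k (n + k)"
  by (simp add: coordinate_polytope_def simple_vertex_polytope_cut)

lemma coordinate_polytope_exists:
  assumes "3 \<le> k" "k + 1 \<le> n" "n \<noteq> k + 2"
  shows "coordinate_polytope TYPE('a::euclidean_space) k n"
proof -
  let ?R = "coordinate_polytope TYPE('a)"
  have two: "?R 2 (3 + 2 * j)" for j
  proof (induction j)
    case 0
    show ?case
      using coordinate_polytope_Suc[OF coordinate_polytope_Suc[OF coordinate_polytope_0[where 'a='a]]]
      by (simp add: numeral_eq_Suc)
  next
    case (Suc j)
    from coordinate_polytope_cut[OF this] show ?case by (simp add: algebra_simps)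
  qed
  have even: "?R 3 (4 + 2 * j)" for j
    using coordinate_polytope_Suc[OF two[of j]] by (simp add: numeral_eq_Suc)
  \<comment> \<open>In dimension three a cut adds three vertices and changes parity; starting from 4
    it passes over 5.\<close>
  have odd: "?R 3 (7 + 2 * j)" for j
    using coordinate_polytope_cut[OF even[of j]] by (simp add: algebra_simps)
  have up: "?R (3 + i) (m + i)" if "?R 3 m" for i m
    using that by (induction i) (auto dest: coordinate_polytope_Suc)
  define i where "i = k - 3"
  have k: "k = 3 + i" using assms by (simp add: i_def)
  have "(\<exists>j. n - i = 4 + 2 * j) \<or> (\<exists>j. n - i = 7 + 2 * j)"
    using assms unfolding k by presburger
  then have "?R 3 (n - i)" using even odd by auto
  from up[OF this, of i] show ?thesis using assms by (simp add: k)
qed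

section \<open>Existence of the polytopes\<close>

lemma neg_polar_hull:
  fixes V :: "'a::real_inner set"
  shows "uminus ` polar (convex hull V) = {x. \<forall>v\<in>V. -1 \<le> x \<bullet> v}"
proof -
  have "x \<in> polar (convex hull V)" if x: "\<forall>v\<in>V. x \<bullet> v \<le> 1" for x
  proof -
    have "convex hull V \<subseteq> {y. x \<bullet> y \<le> 1}"
      by (rule hull_minimal) (use x in \<open>auto simp: convex_halfspace_le\<close>)
    then show ?thesis by (auto simp: polar_def)
  qed
  then have "polar (convex hull V) = {x. \<forall>v\<in>V. x \<bullet> v \<le> 1}"
    by (auto simp: polar_def hull_inc)
  moreover have "uminus ` A = {x. - x \<in> A}" for A :: "'a set"
    by (auto intro: rev_image_eqI[where x = "- _"])
  ultimately show ?thesis by (simp add: minus_le_iff)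
qed

text \<open>By Cauchy-Schwarz, a small ball around 0 satisfies the finitely many constraints; this
  yields full dimension.\<close>

lemma (in neg_self_polar) interior_hull:
  assumes "S = UNIV"
  shows "interior (convex hull V) \<noteq> {}"
proof -
  obtain B where B: "\<And>p. p \<in> V \<Longrightarrow> norm p \<le> B" "0 < B"
    using finite_imp_bounded[OF finite_V] bounded_pos by metis
  have "ball 0 (1 / B) \<subseteq> convex hull V"
  proof
    fix y :: 'a assume "y \<in> ball 0 (1 / B)"
    then have y: "norm y \<le> 1 / B" by simp
    have "-1 \<le> y \<bullet> p" if "p \<in> V" for p
    proof -
      have "\<bar>y \<bullet> p\<bar> \<le> norm y * norm p" by (rule Cauchy_Schwarz_ineq2)
      also have "\<dots> \<le> 1 / B * B" using y B that by (intro mult_mono) auto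
      finally show ?thesis using B by simp
    qed
    then show "y \<in> convex hull V" by (simp add: hull_V assms)
  qed
  then have "ball 0 (1 / B) \<subseteq> interior (convex hull V)" by (simp add: interior_maximal)
  moreover have "(0::'a) \<in> ball 0 (1 / B)" using B by simp
  ultimately show ?thesis by blast
qed

lemma neg_self_polar_polytope_exists:
  assumes "3 \<le> DIM('a::euclidean_space)" "DIM('a) + 1 \<le> n" "n \<noteq> DIM('a) + 2"
  shows "\<exists>P :: 'a set. polytope P \<and> aff_dim P = int DIM('a) \<and>
    card {v. v extreme_point_of P} = n \<and> P = uminus ` polar P"
proof -
  have "simple_vertex_polytope (span (Basis :: 'a set)) DIM('a) n"
    using coordinate_polytope_exists[OF assms, where 'a='a] by (auto simp: coordinate_polytope_def)
  then obtain V :: "'a set" and v u w where V: "simple_vertex UNIV V DIM('a) v u w" "card V = n"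
    by (auto simp: simple_vertex_polytope_def span_Basis)
  interpret simple_vertex UNIV V "DIM('a)" v u w by (rule V(1))
  show ?thesis
  proof (intro exI conjI)
    show "polytope (convex hull V)" using finite_V by (auto simp: polytope_def)
    show "aff_dim (convex hull V) = int DIM('a)"
      by (rule aff_dim_nonempty_interior[OF interior_hull]) simp
    show "card {v. v extreme_point_of (convex hull V)} = n" by (simp add: extreme_points V(2))
    show "convex hull V = uminus ` polar (convex hull V)" unfolding neg_polar_hull using hull_V by simp
  qed
qed

section \<open>Impossibility of \<open>d + 2\<close> vertices\<close>

text \<open>With fewer active constraints, some nonzero \<open>z\<close> is orthogonal to all of
  them. The remaining constraints are strict at \<open>a\<close>, so \<open>a\<close> is the
  midpoint of a short segment of \<open>P\<close> along \<open>z\<close>.\<close>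

lemma active_at_extreme_point:
  fixes V :: "'a::euclidean_space set"
  assumes fin: "finite V" and P: "P = {x. \<forall>v\<in>V. -1 \<le> x \<bullet> v}" and a: "a extreme_point_of P"
  shows "DIM('a) \<le> card {u \<in> V. a \<bullet> u = -1}"
proof (rule ccontr)
  define A where "A = {u \<in> V. a \<bullet> u = -1}"
  assume "\<not> DIM('a) \<le> card {u \<in> V. a \<bullet> u = -1}"
  then have less: "card A < DIM('a)" by (simp add: A_def)
  have "finite A" using fin by (simp add: A_def)
  then have "dim (span A) < DIM('a)" using less dim_le_card'[of A] by simp
  then obtain z where z: "z \<noteq> 0" "\<And>y. y \<in> span A \<Longrightarrow> orthogonal z y"
    using orthogonal_to_subspace_exists[of A] by (auto simp: orthogonal_commute)
  have zA: "z \<bullet> y = 0" if "y \<in> A" for y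
    using z(2)[OF span_base[OF that]] by (simp add: orthogonal_def)
  have aP: "a \<in> P" using a by (simp add: extreme_point_of_def)
  have "\<forall>\<^sub>F t in at_right (0::real). \<forall>u\<in>V - A. t * \<bar>z \<bullet> u\<bar> < a \<bullet> u + 1"
    unfolding eventually_ball_finite_distrib[OF finite_Diff[OF fin]]
  proof
    fix u assume "u \<in> V - A"
    then have "0 < a \<bullet> u + 1" using aP by (auto simp: P A_def less_le)
    moreover have "((\<lambda>t. t * \<bar>z \<bullet> u\<bar>) \<longlongrightarrow> 0 * \<bar>z \<bullet> u\<bar>) (at_right 0)" by (intro tendsto_intros)
    ultimately show "\<forall>\<^sub>F t in at_right 0. t * \<bar>z \<bullet> u\<bar> < a \<bullet> u + 1"
      by (auto dest!: order_tendstoD(2))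
  qed
  moreover have "\<forall>\<^sub>F t in at_right (0::real). 0 < t" by (simp add: eventually_at_right_less)
  ultimately have "\<forall>\<^sub>F t in at_right (0::real). 0 < t \<and> (\<forall>u\<in>V - A. t * \<bar>z \<bullet> u\<bar> < a \<bullet> u + 1)"
    by (auto elim: eventually_elim2)
  then have "\<exists>t::real. 0 < t \<and> (\<forall>u\<in>V - A. t * \<bar>z \<bullet> u\<bar> < a \<bullet> u + 1)"
    by (rule eventually_happens'[rotated]) simp
  then obtain t :: real where t: "0 < t" "\<And>u. u \<in> V - A \<Longrightarrow> t * \<bar>z \<bullet> u\<bar> < a \<bullet> u + 1"
    by blast
  have in_P: "a + c *\<^sub>R z \<in> P" if c: "\<bar>c\<bar> = t" for c
    unfolding P
  proof (intro CollectI ballI)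
    fix u assume u: "u \<in> V"
    show "-1 \<le> (a + c *\<^sub>R z) \<bullet> u"
    proof (cases "u \<in> A")
      case True
      then show ?thesis using zA by (simp add: inner_add_left A_def)
    next
      case False
      then have "\<bar>c * (z \<bullet> u)\<bar> < a \<bullet> u + 1" using t(2) u c by (simp add: abs_mult)
      then show ?thesis by (simp add: inner_add_left)
    qed
  qed
  have "a \<in> open_segment (a + (- t) *\<^sub>R z) (a + t *\<^sub>R z)"
    unfolding in_segment using z(1) t(1)
    by (auto intro!: exI[of _ "1/2"] simp: algebra_simps simp flip: scaleR_add_left)
  then show False using a in_P[of t] in_P[of "- t"] t(1) by (auto simp: extreme_point_of_def)
qed

lemma no_neg_self_polar_polytope:
  fixes P :: "'a::euclidean_space set"
  assumes poly: "polytope P" and self: "P = uminus ` polar P"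
  shows "card {v. v extreme_point_of P} \<noteq> DIM('a) + 2"
proof
  define V where "V = {v. v extreme_point_of P}"
  assume "card {v. v extreme_point_of P} = DIM('a) + 2"
  then have card: "card V = DIM('a) + 2" by (simp add: V_def)
  then have fin: "finite V" using card.infinite by force
  have "P = convex hull V"
    unfolding V_def using poly polytope_imp_compact polytope_imp_convex Krein_Milman_Minkowski by blast
  then have P: "P = {x. \<forall>v\<in>V. -1 \<le> x \<bullet> v}" using self neg_polar_hull by metis
  define N where "N = (\<lambda>a. {b \<in> V. a \<bullet> b \<noteq> -1})"
  have N: "card (N a) \<le> 2" if "a \<in> V" for a
  proof -
    have "DIM('a) \<le> card {u \<in> V. a \<bullet> u = -1}"
      using active_at_extreme_point[OF fin P] that by (simp add: V_def)
    moreover have "card V = card {u \<in> V. a \<bullet> u = -1} + card (N a)"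
      unfolding N_def using fin by (subst card_Un_disjoint[symmetric]) (auto intro!: arg_cong[of _ _ card])
    ultimately show ?thesis using card by simp
  qed
  \<comment> \<open>\<open>a\<close> always belongs to \<open>N a\<close>, since
    \<open>a \<bullet> a\<close> is nonnegative; this leaves room for one other point.\<close>
  have N_eq: "N a = {a, b}" if "a \<in> V" "b \<in> V" "a \<noteq> b" "a \<bullet> b \<noteq> -1" for a b
  proof -
    have "{a, b} \<subseteq> N a" using that inner_self_ne_minus_one by (auto simp: N_def)
    moreover have "finite (N a)" using fin by (simp add: N_def)
    ultimately show ?thesis using N[OF that(1)] that(3) card_seteq[of "N a" "{a, b}"] by simp
  qed
  have "affine_dependent V" using affine_dependent_biggerset[OF fin] card by simp
  then obtain l where l: "sum l V = 0" "(\<Sum>v\<in>V. l v *\<^sub>R v) = 0" "\<exists>a\<in>V. l a \<noteq> 0"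
    using affine_dependent_explicit_finite[OF fin] by blast
  have rel: "(\<Sum>b\<in>V. l b * (a \<bullet> b + 1)) = 0" for a
  proof -
    have "(\<Sum>b\<in>V. l b * (a \<bullet> b + 1)) = a \<bullet> (\<Sum>v\<in>V. l v *\<^sub>R v) + sum l V"
      by (simp add: inner_sum_right sum.distrib distrib_left)
    then show ?thesis using l by simp
  qed
  obtain a where a: "a \<in> V" "l a \<noteq> 0" using l(3) by blast
  \<comment> \<open>Otherwise the relation at \<open>a\<close> would reduce to its diagonal term,
    which is nonzero.\<close>
  have "\<exists>b\<in>V - {a}. l b * (a \<bullet> b + 1) \<noteq> 0"
  proof (rule ccontr)
    assume "\<not> ?thesis"
    then have "(\<Sum>b\<in>V. l b * (a \<bullet> b + 1)) = l a * (a \<bullet> a + 1)"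
      using fin a(1) by (subst sum.remove[of _ a]) (auto intro!: sum.neutral)
    then show False using rel[of a] a(2) inner_self_ne_minus_one[of a] by (simp add: add_eq_0_iff2)
  qed
  then obtain b where b: "b \<in> V" "b \<noteq> a" "a \<bullet> b \<noteq> -1" by (auto simp: add_eq_0_iff2)
  have Na: "N a = {a, b}" by (rule N_eq[OF a(1) b(1) b(2)[symmetric] b(3)])
  have Nb: "N b = {b, a}" by (rule N_eq[OF b(1) a(1) b(2)]) (use b(3) in \<open>simp add: inner_commute[of b]\<close>)
  have pair: "l a * (c \<bullet> a + 1) + l b * (c \<bullet> b + 1) = 0" if "N c = {a, b}" for c
  proof -
    have "c \<bullet> p = -1" if "p \<in> V - {a, b}" for p
      using that \<open>N c = {a, b}\<close> unfolding N_def by blast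
    then have "(\<Sum>p\<in>V. l p * (c \<bullet> p + 1)) = (\<Sum>p\<in>{a, b}. l p * (c \<bullet> p + 1))"
      using fin a(1) b(1) by (intro sum.mono_neutral_right) auto
    then show ?thesis using rel[of c] b(2) by simp
  qed
  \<comment> \<open>This is the squared norm of
    \<open>l a *\<^sub>R (a, 1) + l b *\<^sub>R (b, 1)\<close>; it vanishes because the relations at
    \<open>a\<close> and \<open>b\<close> both reduce to these two terms.\<close>
  have "(l a + l b)\<^sup>2 + (l a *\<^sub>R a + l b *\<^sub>R b) \<bullet> (l a *\<^sub>R a + l b *\<^sub>R b)
      = l a * (l a * (a \<bullet> a + 1) + l b * (a \<bullet> b + 1)) + l b * (l a * (b \<bullet> a + 1) + l b * (b \<bullet> b + 1))"
    by (simp add: inner_add_left inner_add_right power2_eq_square inner_commute[of b a] algebra_simps)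
  also have "\<dots> = 0" using pair Na Nb by (simp add: insert_commute)
  finally have "(l a + l b)\<^sup>2 = 0 \<and> (l a *\<^sub>R a + l b *\<^sub>R b) \<bullet> (l a *\<^sub>R a + l b *\<^sub>R b) = 0"
    by (subst add_nonneg_eq_0_iff[symmetric]) auto
  then have "l b = - l a" "l a *\<^sub>R a + l b *\<^sub>R b = 0" by (auto simp: eq_neg_iff_add_eq_0 add.commute)
  then have "l a *\<^sub>R (a - b) = 0" by (simp add: scaleR_diff_right)
  then show False using a(2) b(2) by simp
qed

theorem theorem6p1:
  fixes n :: nat
  assumes "CARD('d::finite) \<ge> 3" and "n \<ge> CARD('d) + 1"
  shows "(\<exists>P :: (real ^ 'd) set.
            polytope P \<and> aff_dim P = int CARD('d) \<and>
            card {v. v extreme_point_of P} = n \<and>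
            P = uminus ` polar P)
         \<longleftrightarrow> n \<noteq> CARD('d) + 2"
  using assms no_neg_self_polar_polytope[where 'a="real ^ 'd"]
    neg_self_polar_polytope_exists[where 'a="real ^ 'd" and n=n]
  by auto

end
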